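(* Let $X$ be a real Hilbert space, let $K_1,\dots,K_r\subset X$ be closed convex sets with $K:=\bigcap_{l=1}^r K_l\neq\emptyset$, and let $x_0\in X$ be any starting point. Let $\{x_i\}$ be the sequence produced by the best approximation algorithm (described in the context) started at $x_0$, using either the cyclic choice $J_i=\{[i]\}$ for all $i\ge 1$, or the full choice $J_i=\{1,\dots,r\}$ for all $i\geq 1$. Then in either case $\{x_i\}$ converges strongly (in norm) to $P_K(x_0)$.
   Context: $P_C$ denotes the metric projection onto a nonempty closed convex set $C$. For $i\in\mathbb{N}$, $i\geq 1$, $[i]$ denotes the unique element of $\{1,\dots,r\}$ congruent to $i$ modulo $r$. Best approximation algorithm: given $x_0\in X$, for $i=1,2,\dots$ choose $J_i\subset\{1,\dots,r\}$; for each $j\in J_i$ set $$x_i^{(j)}=P_{K_j}(x_{i-1}),\quad a_i^{(j)}=x_{i-1}-x_i^{(j)},\quad b_i^{(j)}=\langle a_i^{(j)},x_i^{(j)}\rangle;$$ define $$F_i:=\{x\in X\mid \langle a_l^{(j)},x\rangle\leq b_l^{(j)}\text{ for all } l=1,\dots,i\text{ and } j\in J_l\},$$ and set $x_i=P_{F_i}(x_0)$ (the projection of the original starting point $x_0$). If $a_l^{(j)}=0$ the corresponding constraint is the trivial one $0\le 0$. *)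

theory Defs
  imports "HOL-Analysis.Analysis"
begin

(* The library's closest_point is restricted to Heine-Borel (finite-dimensional) spaces. As usual
   for THE, the value is unspecified unless a unique nearest point exists, which is the case for
   every nonempty closed convex C in a Hilbert space. *)
definition metric_proj :: "'a::real_inner set \<Rightarrow> 'a \<Rightarrow> 'a" where
  "metric_proj C x = (THE p. p \<in> C \<and> (\<forall>y\<in>C. dist x p \<le> dist x y))"

definition cyc :: "nat \<Rightarrow> nat \<Rightarrow> nat" where
  "cyc r i = (THE k. k \<in> {1..r} \<and> k mod r = i mod r)"

lemma cyc_unique:
  fixes r i :: nat
  assumes "1 \<le> r"
  shows "\<exists>!k. k \<in> {1..r} \<and> k mod r = i mod r"
proof
  show "(if i mod r = 0 then r else i mod r) \<in> {1..r} \<and>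
        (if i mod r = 0 then r else i mod r) mod r = i mod r"
    using assms by (auto intro: less_imp_le)
next
  fix k assume k: "k \<in> {1..r} \<and> k mod r = i mod r"
  show "k = (if i mod r = 0 then r else i mod r)"
  proof (cases "k = r")
    case True
    then show ?thesis using k by simp
  next
    case False
    then show ?thesis using k by auto
  qed
qed

(* In the following, K j is the j-th set, J i the set of indices selected in step i, and x the
   sequence of iterates; x_i^(j), a_i^(j), b_i^(j) are meant for i >= 1 and depend on x only
   through x (i - 1). *)
definition step_point :: "(nat \<Rightarrow> 'a::real_inner set) \<Rightarrow> (nat \<Rightarrow> 'a) \<Rightarrow> nat \<Rightarrow> nat \<Rightarrow> 'a" where
  "step_point K x i j = metric_proj (K j) (x (i - 1))"

definition step_normal :: "(nat \<Rightarrow> 'a::real_inner set) \<Rightarrow> (nat \<Rightarrow> 'a) \<Rightarrow> nat \<Rightarrow> nat \<Rightarrow> 'a" where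
  "step_normal K x i j = x (i - 1) - step_point K x i j"

definition step_offset :: "(nat \<Rightarrow> 'a::real_inner set) \<Rightarrow> (nat \<Rightarrow> 'a) \<Rightarrow> nat \<Rightarrow> nat \<Rightarrow> real" where
  "step_offset K x i j = inner (step_normal K x i j) (step_point K x i j)"

definition constraint_set ::
    "(nat \<Rightarrow> 'a::real_inner set) \<Rightarrow> (nat \<Rightarrow> nat set) \<Rightarrow> (nat \<Rightarrow> 'a) \<Rightarrow> nat \<Rightarrow> 'a set" where
  "constraint_set K J x i =
    {y. \<forall>l\<in>{1..i}. \<forall>j\<in>J l. inner (step_normal K x l j) y \<le> step_offset K x l j}"

(* The i-th constraint set uses only the iterates before x_i, so the recursion below is
   well-founded. *)
lemma constraint_set_cong [fundef_cong]:
  assumes "K = K'" "J = J'" "i = i'" "\<And>n. n < i' \<Longrightarrow> x n = x' n"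
  shows "constraint_set K J x i = constraint_set K' J' x' i'"
proof -
  have "step_normal K x l j = step_normal K' x' l j"
       "step_offset K x l j = step_offset K' x' l j" if "l \<in> {1..i'}" for l j
  proof -
    have "x (l - 1) = x' (l - 1)"
      using that by (intro assms(4)) auto
    then show "step_normal K x l j = step_normal K' x' l j"
              "step_offset K x l j = step_offset K' x' l j"
      by (simp_all add: assms(1) step_offset_def step_normal_def step_point_def)
  qed
  then show ?thesis
    by (auto simp: constraint_set_def assms(2,3))
qed

function best_approx ::
    "(nat \<Rightarrow> 'a::real_inner set) \<Rightarrow> (nat \<Rightarrow> nat set) \<Rightarrow> 'a \<Rightarrow> nat \<Rightarrow> 'a" where
  "best_approx K J x0 i =
    (if i = 0 then x0 else metric_proj (constraint_set K J (best_approx K J x0) i) x0)"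
  by auto
termination
  by (relation "Wellfounded.measure (\<lambda>(K, J, x0, i). i)") auto

declare best_approx.simps [simp del]

end

theory Submission
  imports Defs
begin

text \<open>
  The constraint sets \<open>F\<^sub>i\<close> decrease with \<open>i\<close>, and each of them contains \<open>K\<close>: the obtuse-angle
  property of the projection onto \<open>K\<^sub>j\<close> says exactly that \<open>K\<^sub>j\<close> lies in every half-space cut out by
  that projection. Hence the distances \<open>dist x\<^sub>0 x\<^sub>i\<close> from \<open>x\<^sub>0\<close> to \<open>F\<^sub>i\<close> increase and are bounded by
  the distance to \<open>K\<close>.

  Norm convergence of the iterates comes from the parallelogram law. For \<open>m \<le> n\<close> the midpoint of
  \<open>x\<^sub>m\<close> and \<open>x\<^sub>n\<close> lies in \<open>F\<^sub>m\<close> and so is no nearer to \<open>x\<^sub>0\<close> than \<open>x\<^sub>m\<close>; as the distances to \<open>x\<^sub>0\<close>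
  converge, this makes the sequence Cauchy (\<open>Cauchy_nested_minimizing\<close>). The same lemma, for a
  constant sequence of sets, yields the existence of projections.

  Let \<open>z\<close> be the limit. The new iterate \<open>x\<^sub>i\<close> lies beyond the hyperplane through \<open>P\<^bsub>K\<^sub>j\<^esub> x\<^bsub>i-1\<^esub>\<close> that
  supports \<open>K\<^sub>j\<close>, so for \<open>j \<in> J\<^sub>i\<close> the step from \<open>x\<^bsub>i-1\<^esub>\<close> to \<open>x\<^sub>i\<close> is at least as long as the distance
  from \<open>x\<^bsub>i-1\<^esub>\<close> to \<open>K\<^sub>j\<close>. Step lengths tend to \<open>0\<close>, and each \<open>j\<close> is selected infinitely often, so \<open>z\<close>
  belongs to every \<open>K\<^sub>j\<close>. No point of \<open>K\<close> is nearer to \<open>x\<^sub>0\<close> than the iterates, hence none is nearer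
  than \<open>z\<close>, and \<open>z\<close> is the projection of \<open>x\<^sub>0\<close> onto \<open>K\<close>. The argument works for every selection
  \<open>J\<close> that picks each index infinitely often, of which the cyclic and the full choice are instances.
\<close>

section \<open>Projections onto closed convex sets\<close>

text \<open>The parallelogram law for \<open>x - y\<close> and \<open>x - z\<close>, whose sum is twice the vector from the midpoint
  of \<open>y\<close> and \<open>z\<close> to \<open>x\<close>.\<close>

lemma dist_square_parallelogram:
  fixes x y z :: "'a::real_inner"
  shows "(dist y z)\<^sup>2 = 2 * (dist x y)\<^sup>2 + 2 * (dist x z)\<^sup>2 - 4 * (dist x (midpoint y z))\<^sup>2"
proof -
  have "x - midpoint y z = (1/2) *\<^sub>R ((x - y) + (x - z))"
    by (simp add: midpoint_def algebra_simps flip: scaleR_add_left)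
  then have "4 * (dist x (midpoint y z))\<^sup>2 = (norm ((x - y) + (x - z)))\<^sup>2"
    by (simp add: dist_norm power_divide)
  moreover have "dist y z = norm ((x - y) - (x - z))"
    by (simp add: dist_norm norm_minus_commute)
  ultimately show ?thesis
    by (simp add: dist_norm power2_norm_eq_inner inner_simps inner_commute)
qed

text \<open>The midpoint of two almost nearest points of a convex set is itself no nearer than the
  distance to the set, so by the parallelogram law the two points are close to each other. Letting
  the set shrink along the sequence costs nothing: two members always lie in the earlier set.\<close>

lemma Cauchy_nested_minimizing:
  fixes C :: "nat \<Rightarrow> 'a::real_inner set"
  assumes conv: "\<And>n. convex (C n)" and dec: "decseq C" and mem: "\<And>n. y n \<in> C n"
    and inf: "(\<lambda>n. infdist x (C n)) \<longlonglongrightarrow> \<delta>" and dst: "(\<lambda>n. dist x (y n)) \<longlonglongrightarrow> \<delta>"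
  shows "Cauchy y"
proof (rule metric_CauchyI)
  fix e :: real assume e: "e > 0"
  have "eventually (\<lambda>n. (infdist x (C n))\<^sup>2 > \<delta>\<^sup>2 - e\<^sup>2 / 8) sequentially"
    by (rule order_tendstoD(1)[OF tendsto_power[OF inf]]) (use e in auto)
  moreover have "eventually (\<lambda>n. (dist x (y n))\<^sup>2 < \<delta>\<^sup>2 + e\<^sup>2 / 8) sequentially"
    by (rule order_tendstoD(2)[OF tendsto_power[OF dst]]) (use e in auto)
  ultimately have "eventually (\<lambda>n. (infdist x (C n))\<^sup>2 > \<delta>\<^sup>2 - e\<^sup>2 / 8 \<and>
      (dist x (y n))\<^sup>2 < \<delta>\<^sup>2 + e\<^sup>2 / 8) sequentially"
    by (rule eventually_conj)
  then obtain N where N: "\<And>n. n \<ge> N \<Longrightarrow> (infdist x (C n))\<^sup>2 > \<delta>\<^sup>2 - e\<^sup>2 / 8"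
      "\<And>n. n \<ge> N \<Longrightarrow> (dist x (y n))\<^sup>2 < \<delta>\<^sup>2 + e\<^sup>2 / 8"
    by (auto simp: eventually_sequentially)
  have close: "dist (y m) (y n) < e" if "N \<le> m" "m \<le> n" for m n
  proof -
    have "y n \<in> C m"
      using mem[of n] decseqD[OF dec \<open>m \<le> n\<close>] by blast
    then have "midpoint (y m) (y n) \<in> C m"
      using convexD_alt[OF conv mem, of "y n" m "1/2"]
      by (simp add: midpoint_def algebra_simps)
    then have "(infdist x (C m))\<^sup>2 \<le> (dist x (midpoint (y m) (y n)))\<^sup>2"
      by (intro power_mono infdist_le infdist_nonneg)
    then have "(dist (y m) (y n))\<^sup>2 < e\<^sup>2"
      using dist_square_parallelogram[of "y m" "y n" x] N(1)[of m] N(2)[of m] N(2)[of n] that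
      by simp
    then show ?thesis
      using e by (simp add: power_less_imp_less_base)
  qed
  show "\<exists>M. \<forall>m\<ge>M. \<forall>n\<ge>M. dist (y m) (y n) < e"
  proof (intro exI allI impI)
    fix m n assume "N \<le> m" "N \<le> n"
    then show "dist (y m) (y n) < e"
      using close[of m n] close[of n m] by (cases "m \<le> n") (auto simp: dist_commute)
  qed
qed

lemma nearest_point_exists:
  fixes C :: "'a::{real_inner, complete_space} set"
  assumes "closed C" "convex C" "C \<noteq> {}"
  shows "\<exists>p\<in>C. \<forall>y\<in>C. dist x p \<le> dist x y"
proof -
  have "\<exists>y\<in>C. dist x y < infdist x C + 1 / real (Suc n)" for n
    using assms(3) cInf_lessD[of "dist x ` C" "infdist x C + 1 / real (Suc n)"]
    by (auto simp: infdist_def)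
  then obtain y where y: "\<And>n. y n \<in> C" "\<And>n. dist x (y n) < infdist x C + 1 / real (Suc n)"
    by metis
  have lim: "(\<lambda>n. dist x (y n)) \<longlonglongrightarrow> infdist x C"
  proof (rule tendsto_sandwich)
    show "eventually (\<lambda>n. infdist x C \<le> dist x (y n)) sequentially"
      using y(1) by (intro always_eventually allI infdist_le)
    show "eventually (\<lambda>n. dist x (y n) \<le> infdist x C + 1 / real (Suc n)) sequentially"
      using y(2) by (intro always_eventually allI less_imp_le)
    show "(\<lambda>n. infdist x C + 1 / real (Suc n)) \<longlonglongrightarrow> infdist x C"
      using LIMSEQ_inverse_real_of_nat_add[of "infdist x C"] by (simp add: inverse_eq_divide)
  qed (rule tendsto_const)
  have "Cauchy y"
    by (rule Cauchy_nested_minimizing[where C = "\<lambda>_. C", OF _ _ _ _ lim])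
       (use assms y in \<open>auto simp: decseq_def\<close>)
  then obtain p where p: "y \<longlonglongrightarrow> p"
    using Cauchy_convergent convergent_def by blast
  then have "p \<in> C"
    using assms(1) y(1) closed_sequentially by blast
  moreover have "dist x p = infdist x C"
    using LIMSEQ_unique[OF tendsto_dist[OF tendsto_const p] lim] .
  ultimately show ?thesis
    by (metis infdist_le)
qed

lemma metric_proj_eqI:
  assumes "closed C" "convex C" "p \<in> C" "\<And>y. y \<in> C \<Longrightarrow> dist x p \<le> dist x y"
  shows "metric_proj C x = p"
  unfolding metric_proj_def
  by (rule the_equality) (use assms any_closest_point_unique[of C] in blast)+

lemma metric_proj:
  fixes C :: "'a::{real_inner, complete_space} set"
  assumes "closed C" "convex C" "C \<noteq> {}"
  shows "metric_proj C x \<in> C" and "y \<in> C \<Longrightarrow> dist x (metric_proj C x) \<le> dist x y"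
  using nearest_point_exists[OF assms, of x] metric_proj_eqI[OF assms(1,2)] by metis+

lemma metric_proj_obtuse:
  fixes C :: "'a::{real_inner, complete_space} set"
  assumes "closed C" "convex C" "y \<in> C"
  shows "inner (x - metric_proj C x) (y - metric_proj C x) \<le> 0"
  using assms by (intro any_closest_point_dot[of C]) (auto intro: metric_proj)

section \<open>The constraint sets\<close>

lemma constraint_set_eq_Inter:
  "constraint_set K J x i =
    (\<Inter>l\<in>{1..i}. \<Inter>j\<in>J l. {y. inner (step_normal K x l j) y \<le> step_offset K x l j})"
  by (auto simp: constraint_set_def)

lemma closed_constraint_set: "closed (constraint_set K J x i)"
  unfolding constraint_set_eq_Inter by (intro closed_INT ballI closed_halfspace_le)

lemma convex_constraint_set: "convex (constraint_set K J x i)"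
  unfolding constraint_set_eq_Inter by (intro convex_INT convex_halfspace_le)

lemma decseq_constraint_set: "decseq (constraint_set K J x)"
  by (auto simp: decseq_def constraint_set_def)

lemma Inter_subset_constraint_set:
  fixes K :: "nat \<Rightarrow> 'a::{real_inner, complete_space} set"
  assumes "\<And>l. l \<in> I \<Longrightarrow> closed (K l)" "\<And>l. l \<in> I \<Longrightarrow> convex (K l)" "\<And>i. J i \<subseteq> I"
  shows "(\<Inter>l\<in>I. K l) \<subseteq> constraint_set K J x i"
proof
  fix y assume y: "y \<in> (\<Inter>l\<in>I. K l)"
  have "inner (step_normal K x l j) y \<le> step_offset K x l j" if "j \<in> J l" for l j
  proof -
    have "j \<in> I" using that assms(3) by blast
    then have "inner (step_normal K x l j) (y - step_point K x l j) \<le> 0"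
      unfolding step_normal_def step_point_def
      using assms y by (intro metric_proj_obtuse) auto
    then show ?thesis
      by (simp add: step_offset_def inner_diff_right)
  qed
  then show "y \<in> constraint_set K J x i"
    by (simp add: constraint_set_def)
qed

text \<open>Going from \<open>x\<^bsub>i-1\<^esub>\<close> to any point satisfying the new constraints means crossing the hyperplane
  through \<open>P\<^bsub>K\<^sub>j\<^esub> x\<^bsub>i-1\<^esub>\<close> orthogonal to \<open>x\<^bsub>i-1\<^esub> - P\<^bsub>K\<^sub>j\<^esub> x\<^bsub>i-1\<^esub>\<close> (if this vector is nonzero), and that
  projection is the point of the hyperplane nearest to \<open>x\<^bsub>i-1\<^esub>\<close>.\<close>

lemma dist_step_point_le:
  assumes "y \<in> constraint_set K J x i" "1 \<le> i" "j \<in> J i"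
  shows "dist (x (i - 1)) (step_point K x i j) \<le> dist (x (i - 1)) y"
proof -
  define a where "a = step_normal K x i j"
  have a: "a = x (i - 1) - step_point K x i j"
    by (simp add: a_def step_normal_def)
  have "inner a y \<le> inner a (step_point K x i j)"
    using assms by (auto simp: constraint_set_def step_offset_def a_def)
  then have "inner a (x (i - 1) - step_point K x i j) \<le> inner a (x (i - 1) - y)"
    by (simp add: inner_diff_right)
  then have "norm a * norm a \<le> inner a (x (i - 1) - y)"
    unfolding a[symmetric] by (simp add: power2_norm_eq_inner flip: power2_eq_square)
  also have "\<dots> \<le> norm a * norm (x (i - 1) - y)"
    by (rule norm_cauchy_schwarz)
  finally have "norm a \<le> norm (x (i - 1) - y)"
    by (cases "a = 0") simp_all
  then show ?thesis
    by (simp add: a dist_norm)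
qed

section \<open>Convergence of the algorithm\<close>

text \<open>Nearness to \<open>x\<^sub>0\<close> passes to the limit from all iterates at once, but membership in \<open>K l\<close> only
  from the steps that select \<open>l\<close>: there the projection onto \<open>K l\<close> is as close to the limit as the
  neighbouring iterates are, up to a constant factor. This is why every index is to recur.\<close>

theorem best_approx_tendsto_metric_proj:
  fixes K :: "nat \<Rightarrow> 'a::{real_inner, complete_space} set"
  assumes cl: "\<And>l. l \<in> I \<Longrightarrow> closed (K l)" and cv: "\<And>l. l \<in> I \<Longrightarrow> convex (K l)"
    and ne: "(\<Inter>l\<in>I. K l) \<noteq> {}"
    and sub: "\<And>i. J i \<subseteq> I" and inf: "\<And>l. l \<in> I \<Longrightarrow> \<exists>\<^sub>\<infinity>i. l \<in> J i"
  shows "best_approx K J x0 \<longlonglongrightarrow> metric_proj (\<Inter>l\<in>I. K l) x0"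
proof -
  define x where "x = best_approx K J x0"
  define F where "F = constraint_set K J x"
  have K_F: "(\<Inter>l\<in>I. K l) \<subseteq> F i" for i
    unfolding F_def using cl cv sub by (rule Inter_subset_constraint_set)
  have F: "closed (F i)" "convex (F i)" "F i \<noteq> {}" for i
    using K_F[of i] ne by (auto simp: F_def closed_constraint_set convex_constraint_set)
  have decF: "decseq F"
    by (simp add: F_def decseq_constraint_set)
  have x_eq: "x i = metric_proj (F i) x0" for i
  proof (cases i)
    case 0
    \<comment> \<open>Without constraints \<open>F\<^sub>0\<close> is the whole space, so the start \<open>x\<^sub>0\<close> fits the same formula.\<close>
    have "metric_proj (F 0) x0 = x0"
      by (intro metric_proj_eqI) (auto simp: F_def constraint_set_def)
    then show ?thesis
      using 0 by (simp add: x_def best_approx.simps)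
  next
    case (Suc n)
    then show ?thesis
      unfolding F_def x_def by (subst best_approx.simps) simp
  qed
  have x_F: "x i \<in> F i" and x_le: "\<And>y. y \<in> F i \<Longrightarrow> dist x0 (x i) \<le> dist x0 y" for i
    using metric_proj[OF F] by (auto simp: x_eq)
  have infd: "infdist x0 (F i) = dist x0 (x i)" for i
  proof (rule antisym)
    show "infdist x0 (F i) \<le> dist x0 (x i)"
      by (rule infdist_le[OF x_F])
    show "dist x0 (x i) \<le> infdist x0 (F i)"
      using F(3) by (auto simp: infdist_def intro!: cINF_greatest x_le)
  qed
  obtain k where k: "k \<in> (\<Inter>l\<in>I. K l)"
    using ne by blast
  have "incseq (\<lambda>i. dist x0 (x i))"
  proof (intro monoI x_le)
    fix m n :: nat assume "m \<le> n"
    then show "x n \<in> F m"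
      using decseqD[OF decF] x_F[of n] by blast
  qed
  moreover have "\<forall>i. dist x0 (x i) \<le> dist x0 k"
    using x_le[OF subsetD[OF K_F k]] by blast
  ultimately obtain \<delta> where \<delta>: "(\<lambda>i. dist x0 (x i)) \<longlonglongrightarrow> \<delta>"
    by (rule incseq_convergent)
  have "Cauchy x"
    by (rule Cauchy_nested_minimizing[OF F(2) decF x_F _ \<delta>]) (simp add: infd \<delta>)
  then obtain z where z: "x \<longlonglongrightarrow> z"
    using Cauchy_convergent convergent_def by blast
  have "z \<in> K l" if l: "l \<in> I" for l
  proof -
    have "\<exists>p\<in>K l. dist p z < e" if "e > 0" for e
    proof -
      obtain N where N: "\<And>n. n \<ge> N \<Longrightarrow> dist (x n) z < e / 3"
        using metric_LIMSEQ_D[OF z, of "e / 3"] \<open>e > 0\<close> by auto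
      obtain i where i: "Suc N \<le> i" "l \<in> J i"
        using inf[OF l] by (auto simp: INFM_nat_le)
      define p where "p = step_point K x i l"
      have "dist (x (i - 1)) p \<le> dist (x (i - 1)) (x i)"
        unfolding p_def by (rule dist_step_point_le) (use x_F[of i] i in \<open>auto simp: F_def\<close>)
      also have "\<dots> \<le> dist (x (i - 1)) z + dist (x i) z"
        by (rule dist_triangle2)
      finally have "dist p z \<le> 2 * dist (x (i - 1)) z + dist (x i) z"
        using dist_triangle3[of p z "x (i - 1)"] by simp
      also have "\<dots> < e"
        using N[of "i - 1"] N[of i] i(1) by fastforce
      finally have "dist p z < e" .
      moreover have "p \<in> K l"
        unfolding p_def step_point_def using cl[OF l] cv[OF l] k l by (intro metric_proj) auto
      ultimately show ?thesis by blast
    qed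
    then show ?thesis
      using closure_approachable[of z "K l"] cl[OF l] by simp
  qed
  moreover have "dist x0 z \<le> dist x0 y" if "y \<in> (\<Inter>l\<in>I. K l)" for y
    by (rule LIMSEQ_le_const2[OF tendsto_dist[OF tendsto_const z]])
       (use x_le[OF subsetD[OF K_F that]] in blast)
  ultimately have "metric_proj (\<Inter>l\<in>I. K l) x0 = z"
    using cl cv by (intro metric_proj_eqI closed_INT convex_INT) auto
  with z show ?thesis
    by (simp add: x_def)
qed

lemma cyc_eqI:
  assumes "1 \<le> r" "k \<in> {1..r}" "k mod r = i mod r"
  shows "cyc r i = k"
  unfolding cyc_def using cyc_unique[OF assms(1), of i] assms by (intro the1_equality) auto

lemma cyc_in_range:
  assumes "1 \<le> r"
  shows "cyc r i \<in> {1..r}"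
  unfolding cyc_def using theI'[OF cyc_unique[OF assms]] by blast

theorem theorem3p3:
  fixes K :: "nat \<Rightarrow> 'a::{real_inner, complete_space} set"
    and r :: nat
    and x0 :: 'a
  assumes "1 \<le> r"
    and "\<And>l. l \<in> {1..r} \<Longrightarrow> closed (K l)"
    and "\<And>l. l \<in> {1..r} \<Longrightarrow> convex (K l)"
    and "(\<Inter>l\<in>{1..r}. K l) \<noteq> {}"
  shows "best_approx K (\<lambda>i. {cyc r i}) x0 \<longlonglongrightarrow> metric_proj (\<Inter>l\<in>{1..r}. K l) x0 \<and>
    best_approx K (\<lambda>i. {1..r}) x0 \<longlonglongrightarrow> metric_proj (\<Inter>l\<in>{1..r}. K l) x0"
proof
  have inf: "\<exists>\<^sub>\<infinity>i. l \<in> {cyc r i}" if "l \<in> {1..r}" for l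
    unfolding INFM_nat_le
  proof (intro allI exI conjI)
    fix m
    show "m \<le> l + m * r"
      using assms(1) by (cases r) auto
    show "l \<in> {cyc r (l + m * r)}"
      using cyc_eqI[OF assms(1) that, of "l + m * r"] by simp
  qed
  show "best_approx K (\<lambda>i. {cyc r i}) x0 \<longlonglongrightarrow> metric_proj (\<Inter>l\<in>{1..r}. K l) x0"
    by (rule best_approx_tendsto_metric_proj[OF assms(2-4)])
       (use inf cyc_in_range[OF assms(1)] in auto)
  show "best_approx K (\<lambda>i. {1..r}) x0 \<longlonglongrightarrow> metric_proj (\<Inter>l\<in>{1..r}. K l) x0"
    by (rule best_approx_tendsto_metric_proj[OF assms(2-4)]) (auto simp: INFM_nat_le)
qed

end
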